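(* Let $m>1$, $f(z)=z^m$, and let $C(t)=\sum_{i=1}^m n_i z_i(t)$ be a balanced cycle of $f$. Let $P_C(z)=n_1+n_2z+\cdots+n_m z^{m-1}$. Then a polynomial $g(z)=\sum_{j=0}^{\ell} b_j z^j\in\mathbb{C}[z]$ satisfies $\int_{C(t)} g\equiv 0$ if and only if, for every $j>1$, one has $b_j=0$ whenever the cyclotomic polynomial $\Phi_{m/k}(z)$ does not divide $P_C(z)$, where $k=\gcd(m,j)$.
   Context: For $f(z)=z^m$ the roots of $f(z)=t$, $t\ne 0$, are numbered $z_i(t)=\epsilon_m^{i-1}s$, $i=1,\dots,m$, where $s$ is a (locally analytic) $m$-th root of $t$ and $\epsilon_m=e^{2\pi i/m}$. A cycle of $f$ is a formal sum $C(t)=\sum_{i=1}^m n_i z_i(t)$ with $n_i\in\mathbb{Z}$, $\sum_i n_i=0$, and $\int_{C(t)} g:=\sum_{i=1}^m n_i g(z_i(t))$; "$\equiv 0$" means identically zero in $t$. For $f(z)=z^m$ a loop winding once anti-clockwise around $0$ induces the permutation $(1,2,\dots,m)$ on the indices, and $C(t)$ is called balanced if $\sum_{i=1}^m n_i\epsilon_m^i=0$ for $\epsilon_m$ a primitive $m$-th root of unity (equivalently $P_C(\epsilon_m)=0$). $\Phi_n(z)$ denotes the $n$-th cyclotomic polynomial. *)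

theory Defs
  imports "HOL-Analysis.Analysis" "HOL-Computational_Algebra.Polynomial"
begin

definition eps :: "nat \<Rightarrow> complex" where
  "eps m = exp (2 * of_real pi * \<i> / of_nat m)"

(* A locally analytic root s of f(z) = t, as t ranges over a domain U that avoids t = 0.
   For f = z^m this is a local branch of the m-th root. *)
definition root_branch :: "complex poly \<Rightarrow> complex set \<Rightarrow> (complex \<Rightarrow> complex) \<Rightarrow> bool" where
  "root_branch f U s \<longleftrightarrow>
     open U \<and> connected U \<and> U \<noteq> {} \<and> 0 \<notin> U \<and>
     s holomorphic_on U \<and> (\<forall>t\<in>U. poly f (s t) = t)"

(* The i-th root z_i(t) of z^m = t, i = 1, ..., m, numbered starting from the branch s. *)
definition nth_root :: "nat \<Rightarrow> (complex \<Rightarrow> complex) \<Rightarrow> nat \<Rightarrow> complex \<Rightarrow> complex" where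
  "nth_root m s i t = eps m ^ (i - 1) * s t"

(* A cycle C(t) = n_1 z_1(t) + ... + n_m z_m(t) is represented by its coefficients n_1, ..., n_m;
   the values of n outside {1..m} are irrelevant. *)
definition is_cycle :: "nat \<Rightarrow> (nat \<Rightarrow> int) \<Rightarrow> bool" where
  "is_cycle m n \<longleftrightarrow> (\<Sum>i=1..m. n i) = 0"

definition balanced :: "nat \<Rightarrow> (nat \<Rightarrow> int) \<Rightarrow> bool" where
  "balanced m n \<longleftrightarrow> (\<Sum>i=1..m. of_int (n i) * eps m ^ i) = 0"

definition cycle_integral ::
    "nat \<Rightarrow> (nat \<Rightarrow> int) \<Rightarrow> (complex \<Rightarrow> complex) \<Rightarrow> complex poly \<Rightarrow> complex \<Rightarrow> complex" where
  "cycle_integral m n s g t = (\<Sum>i=1..m. of_int (n i) * poly g (nth_root m s i t))"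

definition cycle_poly :: "nat \<Rightarrow> (nat \<Rightarrow> int) \<Rightarrow> int poly" where
  "cycle_poly m n = (\<Sum>i=1..m. monom (n i) (i - 1))"

(* The product of z - w over the primitive d-th roots of unity w. It is monic with integer
   coefficients, so it divides an integer polynomial over the complex numbers if and only if it
   does so over the integers. *)
definition cyclotomic :: "nat \<Rightarrow> complex poly" where
  "cyclotomic d = (\<Prod>k | k \<in> {1..d} \<and> coprime k d. [:- (eps d ^ k), 1:])"

end

theory Submission
  imports Defs "HOL-Computational_Algebra.Polynomial_Factorial" "HOL-Number_Theory.Cong"
begin

text \<open>
  Let \<open>P\<close> be the cycle polynomial. Collecting the powers of the branch \<open>s\<close>, the integral of
  \<open>g\<close> along the cycle is \<open>\<Sum>j. b\<^sub>j P(\<epsilon>\<^sup>j) s\<^sup>j\<close> with \<open>\<epsilon>\<close> the root of unity \<open>eps m\<close>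
  (lemma \<open>cycle_integral_eq\<close>). Since \<open>s\<close> takes infinitely many values, this polynomial in \<open>s\<close>
  vanishes identically if and only if, for each \<open>j\<close>, either \<open>b\<^sub>j = 0\<close> or \<open>P(\<epsilon>\<^sup>j) = 0\<close>
  (\<open>cycle_integral_zero_iff\<close>). For \<open>j = 0\<close> the condition \<open>P(1) = 0\<close> says that the coefficients
  of the cycle add up to zero, and for \<open>j = 1\<close> the condition \<open>P(\<epsilon>) = 0\<close> says that the cycle is
  balanced, so only the \<open>j > 1\<close> impose a condition on \<open>g\<close>.

  It remains to see that \<open>P(\<epsilon>\<^sup>j) = 0\<close> means divisibility by a cyclotomic polynomial. The number
  \<open>\<epsilon>\<^sup>j\<close> is a primitive root of unity of order \<open>d = m / gcd m j\<close>, and the \<open>d\<close>-th cyclotomic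
  polynomial is a product of distinct linear factors, one for each such root. What is needed is thus
  that an integer polynomial which vanishes at one primitive \<open>d\<close>-th root of unity vanishes at all
  of them, that is, the irreducibility of the cyclotomic polynomial
  (\<open>conjugate_roots_of_unity\<close>). This follows Dedekind's argument, carried out in the factorial
  ring of integer polynomials. Let \<open>f\<close> be a prime factor of \<open>X\<^sup>d - 1\<close> that vanishes at a root of
  unity \<open>w\<close>, and \<open>h\<close> the cofactor. If \<open>f(w\<^sup>p) \<noteq> 0\<close> for a prime \<open>p\<close> not dividing \<open>d\<close>, then
  \<open>h(w\<^sup>p) = 0\<close>, so \<open>f\<close> divides \<open>h(X\<^sup>p)\<close>, which is congruent to \<open>h\<^sup>p\<close> modulo \<open>p\<close>. Differentiating
  \<open>f h = X\<^sup>d - 1\<close> shows that \<open>h\<close> is invertible modulo \<open>f\<close> up to the factor \<open>d\<close>, so that \<open>f\<close> would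
  divide a nonzero constant modulo \<open>p\<close>, which its positive degree and its leading
  coefficient, a unit, rule out (\<open>vanishing_at_prime_power\<close>).
\<close>

section \<open>Integer polynomials at complex points\<close>

abbreviation int_eval :: "complex \<Rightarrow> int poly \<Rightarrow> complex" where
  "int_eval w P \<equiv> poly (map_poly of_int P) w"

lemma map_poly_of_int_mult:
  "map_poly (of_int :: int \<Rightarrow> 'a::comm_ring_1) (P * Q) = map_poly of_int P * map_poly of_int Q"
  by (rule poly_eqI) (simp add: coeff_map_poly coeff_mult)

lemma map_poly_of_int_add:
  "map_poly (of_int :: int \<Rightarrow> 'a::comm_ring_1) (P + Q) = map_poly of_int P + map_poly of_int Q"
  by (rule poly_eqI) (simp add: coeff_map_poly)

lemma map_poly_of_int_diff:
  "map_poly (of_int :: int \<Rightarrow> 'a::comm_ring_1) (P - Q) = map_poly of_int P - map_poly of_int Q"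
  by (rule poly_eqI) (simp add: coeff_map_poly)

lemmas int_eval_hom =
  map_poly_of_int_mult map_poly_of_int_add map_poly_of_int_diff map_poly_monom map_poly_pCons

lemma int_eval_pcompose: "int_eval w (pcompose P Q) = int_eval (int_eval w Q) P"
  by (induction P) (simp_all add: pcompose_pCons int_eval_hom)

lemma int_eval_const_eq_0:
  assumes "degree P = 0" "int_eval w P = 0"
  shows "P = 0"
  using assms by (auto elim!: degree_eq_zeroE simp: map_poly_pCons)

section \<open>Reduction modulo a prime\<close>

text \<open>
  As a congruence, the freshman's dream makes sense in characteristic zero, where it serves for the
  integers and for integer polynomials alike.
\<close>
lemma freshmans_dream_dvd:
  fixes x y :: "'a::comm_ring_1"
  assumes "prime p"
  shows "of_nat p dvd (x + y) ^ p - (x ^ p + y ^ p)"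
proof -
  have p: "p > 1" using assms prime_gt_1_nat by blast
  have "(x + y) ^ p = (\<Sum>k\<le>p. of_nat (p choose k) * x ^ k * y ^ (p - k))"
    by (rule binomial_ring)
  also have "{..p} = insert 0 (insert p {1..<p})"
    using p by auto
  also have "(\<Sum>k\<in>\<dots>. of_nat (p choose k) * x ^ k * y ^ (p - k)) =
      y ^ p + (x ^ p + (\<Sum>k\<in>{1..<p}. of_nat (p choose k) * x ^ k * y ^ (p - k)))"
    using p by (subst sum.insert; simp)+
  finally have "(x + y) ^ p - (x ^ p + y ^ p) =
      (\<Sum>k\<in>{1..<p}. of_nat (p choose k) * x ^ k * y ^ (p - k))"
    by simp
  also have "of_nat p dvd \<dots>"
  proof (rule dvd_sum)
    fix k assume "k \<in> {1..<p}"
    then have "p dvd (p choose k)"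
      using assms by (intro dvd_choose_prime) auto
    then show "of_nat p dvd (of_nat (p choose k) * x ^ k * y ^ (p - k) :: 'a)"
      by (metis dvd_def dvd_mult2 of_nat_mult)
  qed
  finally show ?thesis .
qed

lemma fermat_little_int:
  fixes a :: int
  assumes "prime p"
  shows "int p dvd a ^ p - a"
proof -
  have p: "p > 0" using assms prime_gt_0_nat by blast
  have nonneg: "int p dvd int k ^ p - int k" for k
  proof (induction k)
    case 0
    then show ?case using p by (simp add: power_0_left)
  next
    case (Suc k)
    have "int p dvd (int k + 1) ^ p - (int k ^ p + 1 ^ p)"
      using freshmans_dream_dvd[OF assms, of "int k" 1] by simp
    from dvd_add[OF this Suc.IH] show ?case by (simp add: algebra_simps)
  qed
  have "[a ^ p = (a mod int p) ^ p] (mod int p)"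
    by (simp add: cong_def power_mod)
  also have "[(a mod int p) ^ p = a mod int p] (mod int p)"
    using nonneg[of "nat (a mod int p)"] p by (simp add: cong_iff_dvd_diff)
  also have "[a mod int p = a] (mod int p)" by (simp add: cong_def)
  finally show ?thesis by (simp add: cong_iff_dvd_diff)
qed

text \<open>
  Modulo \<open>p\<close>, raising a polynomial to the power \<open>p\<close> acts on the variable alone, since the
  coefficients are fixed by Fermat's little theorem.
\<close>
lemma const_poly_dvd_pcompose_power:
  fixes P :: "int poly"
  assumes "prime p"
  shows "[:int p:] dvd pcompose P (monom 1 p) - P ^ p"
proof (induction P)
  case 0
  then show ?case using assms prime_gt_0_nat[of p] by (simp add: power_0_left)
next
  case (pCons a P)
  let ?X = "monom 1 1 :: int poly"
  have split: "pCons a P = [:a:] + ?X * P"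
    by (simp add: monom_altdef)
  have Xp: "monom 1 p = ?X ^ p" by (simp add: monom_power)
  have "of_nat p dvd ([:a:] + ?X * P) ^ p - ([:a:] ^ p + (?X * P) ^ p)"
    by (rule freshmans_dream_dvd[OF assms])
  then have 1: "[:int p:] dvd pCons a P ^ p - ([:a:] ^ p + (?X * P) ^ p)"
    unfolding split by (simp add: of_nat_poly)
  have 2: "[:int p:] dvd [:a:] ^ p - [:a:]"
    using fermat_little_int[OF assms, of a] by (simp add: poly_const_pow)
  have 3: "[:int p:] dvd ?X ^ p * (pcompose P (monom 1 p) - P ^ p)"
    using pCons.IH by (rule dvd_mult)
  have "pcompose (pCons a P) (monom 1 p) - pCons a P ^ p =
    ?X ^ p * (pcompose P (monom 1 p) - P ^ p) - ([:a:] ^ p - [:a:])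
      - (pCons a P ^ p - ([:a:] ^ p + (?X * P) ^ p))"
    by (simp add: pcompose_pCons Xp power_mult_distrib algebra_simps)
  with 1 2 3 show ?case by (metis dvd_diff)
qed

text \<open>
  Modulo \<open>p\<close> the polynomial \<open>f\<close> keeps its positive degree, so it cannot divide a nonzero constant
  there.
\<close>
lemma prime_dvd_const_if_nonconst_dvd_mod:
  fixes f q :: "int poly"
  assumes p: "prime p" and lc: "\<not> p dvd lead_coeff f" and deg: "degree f > 0"
    and dvd: "[:p:] dvd f * q - [:c:]"
  shows "p dvd c"
proof (cases "[:p:] dvd q")
  case True
  have "[:p:] dvd f * q - (f * q - [:c:])"
    by (intro dvd_diff dvd dvd_mult True)
  also have "f * q - (f * q - [:c:]) = [:c:]" by (simp only: diff_diff_eq2 add_diff_cancel_left')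
  finally show ?thesis by (simp only: const_poly_dvd_const_poly_iff)
next
  case False
  \<comment> \<open>The maximum \<open>i\<close> of this set is the degree of \<open>q\<close> modulo \<open>p\<close>; the coefficient of \<open>f * q\<close>
    at \<open>degree f + i\<close> is then, modulo \<open>p\<close>, the product of the two leading coefficients.\<close>
  define I where "I = {i. \<not> p dvd coeff q i}"
  have "I \<subseteq> {..degree q}"
    unfolding I_def by (auto intro!: le_degree)
  then have fin: "finite I" using finite_subset by blast
  have "I \<noteq> {}" using False unfolding I_def by (auto simp: const_poly_dvd_iff)
  define i where "i = Max I"
  have i: "\<not> p dvd coeff q i"
    using Max_in[OF fin \<open>I \<noteq> {}\<close>] unfolding i_def I_def by simp
  have above: "p dvd coeff q j" if "j > i" for j
    using Max_ge[OF fin, of j] that unfolding i_def I_def by force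
  let ?N = "degree f + i"
  have "p dvd coeff (f * q - [:c:]) ?N"
    using dvd by (simp only: const_poly_dvd_iff)
  then have "p dvd coeff (f * q) ?N"
    using deg by (auto simp: coeff_pCons split: nat.splits)
  also have "coeff (f * q) ?N = (\<Sum>k\<le>?N. coeff f k * coeff q (?N - k))"
    by (rule coeff_mult)
  also have "\<dots> = lead_coeff f * coeff q i +
      (\<Sum>k\<in>{..?N} - {degree f}. coeff f k * coeff q (?N - k))"
    by (subst sum.remove[of _ "degree f"]) auto
  finally have "p dvd lead_coeff f * coeff q i +
      (\<Sum>k\<in>{..?N} - {degree f}. coeff f k * coeff q (?N - k))" .
  moreover have "p dvd (\<Sum>k\<in>{..?N} - {degree f}. coeff f k * coeff q (?N - k))"
  proof (rule dvd_sum)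
    fix k assume "k \<in> {..?N} - {degree f}"
    then consider "k < degree f" | "k > degree f" by force
    then show "p dvd coeff f k * coeff q (?N - k)"
    proof cases
      case 1
      then show ?thesis by (intro dvd_mult above) simp
    qed (simp add: coeff_eq_0)
  qed
  ultimately have "p dvd lead_coeff f * coeff q i"
    by (simp add: dvd_add_left_iff)
  with p lc i show ?thesis by (simp add: prime_dvd_mult_iff)
qed

section \<open>Integer polynomials with a common root\<close>

lemma exists_prime_factor_vanishing:
  "P \<noteq> 0 \<Longrightarrow> int_eval w P = 0 \<Longrightarrow> \<exists>f. prime f \<and> f dvd P \<and> int_eval w f = 0"
proof (induction P rule: prime_divisors_induct)
  case (unit P)
  then have "degree P = 0" by (metis is_unit_poly_iff degree_pCons_0)
  with unit show ?case using int_eval_const_eq_0 by blast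
next
  case (factor f P)
  then show ?case by (auto simp: int_eval_hom intro: dvd_mult)
qed simp

text \<open>
  A nonzero integer polynomial \<open>q\<close> of least degree vanishing at \<open>w\<close> divides every other one that
  vanishes at \<open>w\<close> up to an integer factor, by pseudo-division. Such a factor is harmless, because a
  prime polynomial with a complex root is not constant and so divides no nonzero integer. Hence
  \<open>f\<close> divides \<open>q\<close>, and \<open>q\<close> divides a multiple of \<open>P\<close>.
\<close>
lemma prime_dvd_if_common_root:
  assumes f: "prime (f :: int poly)" and fw: "int_eval w f = 0" and Pw: "int_eval w P = 0"
  shows "f dvd P"
proof -
  let ?S = "\<lambda>q. q \<noteq> 0 \<and> int_eval w q = 0"
  have f0: "f \<noteq> 0" using f by auto
  define q where "q = arg_min degree ?S"
  have q: "?S q" and min: "\<And>r. ?S r \<Longrightarrow> degree q \<le> degree r"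
    using arg_min_natI[of ?S f degree] arg_min_nat_le[of ?S _ degree] f0 fw unfolding q_def
    by blast+
  have multiple: "\<exists>a u. a \<noteq> 0 \<and> smult a F = q * u" if "int_eval w F = 0" for F
  proof -
    obtain a u where a: "a \<noteq> 0" and eq: "smult a F = q * u + pseudo_mod F q"
      using pseudo_mod(1)[of q F] q by blast
    have "int_eval w (smult a F) = 0" using that by (simp add: map_poly_smult)
    then have "int_eval w (pseudo_mod F q) = 0" using q unfolding eq by (simp add: int_eval_hom)
    then have "pseudo_mod F q = 0"
      using pseudo_mod(2)[of q F] min[of "pseudo_mod F q"] q by force
    with a eq show ?thesis by auto
  qed
  have const: "\<not> f dvd [:a:]" if "a \<noteq> 0" for a
  proof
    assume "f dvd [:a:]"
    then have "degree f = 0" using dvd_imp_degree_le[of f "[:a:]"] that by simp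
    with fw f0 show False using int_eval_const_eq_0 by blast
  qed
  obtain a u where a: "a \<noteq> 0" and au: "smult a f = q * u" using multiple[OF fw] by blast
  have "f dvd q"
  proof (rule ccontr)
    assume "\<not> f dvd q"
    moreover have "f dvd q * u" unfolding au[symmetric] by (simp add: dvd_smult)
    ultimately obtain v where "u = f * v" using f by (auto simp: prime_dvd_mult_iff)
    then have "f * (q * v) = f * [:a:]" using au by (simp add: algebra_simps)
    then have qv: "q * v = [:a:]" using f0 by (simp only: mult_cancel_left) simp
    then have "degree q = 0" using dvd_imp_degree_le[of q "[:a:]"] a
      by (metis degree_pCons_0 dvd_triv_left le_zero_eq pCons_eq_0_iff)
    with q show False using int_eval_const_eq_0 by blast
  qed
  obtain b v where b: "b \<noteq> 0" and bv: "smult b P = q * v" using multiple[OF Pw] by blast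
  have "f dvd [:b:] * P" using \<open>f dvd q\<close> bv by simp
  with f const[OF b] show ?thesis by (simp add: prime_dvd_mult_iff del: mult_pCons_left)
qed

section \<open>Conjugate roots of unity\<close>

lemma degree_monom_minus_one:
  assumes "d > 0"
  shows "degree (monom 1 d - 1 :: int poly) = d"
  using degree_add_eq_left[of "- 1" "monom (1 :: int) d"] assms
  by (simp add: degree_monom_eq)

text \<open>
  The heart of Dedekind's argument. The usual appeal to the separability of \<open>X\<^sup>d - 1\<close> over the field
  with \<open>p\<close> elements is replaced by an identity over the integers: with \<open>A = X f'\<close>, the derivative of
  \<open>f h = X\<^sup>d - 1\<close> gives \<open>h A \<equiv> d\<close> modulo \<open>f\<close>, whereas \<open>h\<^sup>p\<close> is divisible by \<open>p\<close> modulo \<open>f\<close> if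
  \<open>w\<^sup>p\<close> is a root of \<open>h\<close>. Together these say that \<open>f\<close> divides \<open>d\<^sup>p\<close> modulo \<open>p\<close>.
\<close>
lemma vanishing_at_prime_power:
  assumes f: "prime (f :: int poly)" and dvd: "f dvd monom 1 d - 1"
    and fw: "int_eval w f = 0" and p: "prime p" and pd: "\<not> p dvd d"
  shows "int_eval (w ^ p) f = 0"
proof (rule ccontr)
  assume contra: "int_eval (w ^ p) f \<noteq> 0"
  obtain h where h: "monom 1 d - 1 = f * h" using dvd by blast
  have d: "d > 0" using pd by (cases d) auto
  have wd: "int_eval w (monom 1 d - 1) = 0"
    unfolding h using fw by (simp add: int_eval_hom)
  then have "w ^ d = 1" by (simp add: int_eval_hom poly_monom)
  then have "int_eval (w ^ p) (monom 1 d - 1) = 0"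
    by (simp add: int_eval_hom poly_monom flip: power_mult) (simp add: mult.commute[of p] power_mult)
  then have "int_eval (w ^ p) h = 0"
    using contra unfolding h by (simp add: int_eval_hom)
  then have "int_eval w (pcompose h (monom 1 p)) = 0"
    by (simp add: int_eval_pcompose int_eval_hom poly_monom)
  then have f_dvd_hp: "f dvd pcompose h (monom 1 p)"
    by (rule prime_dvd_if_common_root[OF f fw])
  obtain R where R: "pcompose h (monom 1 p) - h ^ p = [:int p:] * R"
    using const_poly_dvd_pcompose_power[OF p, of h] by blast
  define A where "A = monom 1 1 * pderiv f"
  \<comment> \<open>Multiplying the derivative by \<open>X\<close> turns \<open>d X\<^bsup>d-1\<^esup>\<close> into \<open>d X\<^sup>d\<close>, which is \<open>d\<close> modulo \<open>f\<close>.\<close>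
  have "pderiv (monom 1 d - 1 :: int poly) = pderiv f * h + f * pderiv h"
    unfolding h by (simp add: pderiv_mult algebra_simps)
  then have "monom 1 1 * monom (int d) (d - 1) = monom 1 1 * (pderiv f * h + f * pderiv h)"
    by (simp add: pderiv_diff pderiv_monom)
  moreover have "monom 1 1 * monom (int d) (d - 1) = [:int d:] * (f * h + 1)"
    using d unfolding h[symmetric] by (simp add: mult_monom smult_monom)
  ultimately have "h * A - [:int d:] = f * ([:int d:] * h - monom 1 1 * pderiv h)"
    unfolding A_def by (simp add: algebra_simps)
  then have "f dvd h * A - [:int d:]" by simp
  also have "\<dots> dvd (h * A) ^ p - [:int d:] ^ p"
    by (subst power_diff_sumr2) (rule dvd_triv_left)
  finally have "f dvd pcompose h (monom 1 p) * A ^ p - ((h * A) ^ p - [:int d:] ^ p)"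
    by (rule dvd_diff[OF dvd_mult2[OF f_dvd_hp]])
  then obtain q where "pcompose h (monom 1 p) * A ^ p - ((h * A) ^ p - [:int d:] ^ p) = f * q"
    by blast
  moreover have "pcompose h (monom 1 p) = h ^ p + [:int p:] * R" using R by (simp add: algebra_simps)
  ultimately have "f * q - [:int d ^ p:] = [:int p:] * (R * A ^ p)"
    by (simp add: power_mult_distrib poly_const_pow algebra_simps)
  then have mod_p: "[:int p:] dvd f * q - [:int d ^ p:]" by (rule dvdI)
  \<comment> \<open>As \<open>X\<^sup>d - 1\<close> is monic, \<open>f\<close> does not lose degree modulo \<open>p\<close>.\<close>
  have "lead_coeff f * lead_coeff h = lead_coeff (monom 1 d - 1)"
    unfolding h by (simp add: lead_coeff_mult)
  also have "\<dots> = 1" 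
    using d by (simp add: degree_monom_minus_one)
  finally have "lead_coeff f dvd 1" by (rule dvdI[OF sym])
  moreover have "\<not> int p dvd 1" using prime_gt_1_nat[OF p] by simp
  ultimately have lc: "\<not> int p dvd lead_coeff f" using dvd_trans by blast
  have "f \<noteq> 0" using f by auto
  then have "degree f > 0" using int_eval_const_eq_0 fw by blast
  from prime_dvd_const_if_nonconst_dvd_mod[OF _ lc this mod_p]
  have "int p dvd int d ^ p" using p by simp
  then have "int p dvd int d" using p prime_dvd_power[of "int p" "int d" p] by simp
  then have "p dvd d" by simp
  with pd show False by contradiction
qed

text \<open>
  The exponent is reached one prime factor at a time; \<open>w\<close> varies in the induction because each step
  starts at the root produced by the previous one.
\<close>
lemma vanishing_at_coprime_power:
  assumes f: "prime (f :: int poly)" and dvd: "f dvd monom 1 d - 1"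
  shows "coprime k d \<Longrightarrow> k > 0 \<Longrightarrow> int_eval w f = 0 \<Longrightarrow> int_eval (w ^ k) f = 0"
proof (induction k arbitrary: w rule: prime_divisors_induct)
  case (factor p k)
  have cop: "coprime p d" "coprime k d" and k: "k > 0"
    using factor.prems(1,2) by (auto simp only: coprime_mult_left_iff nat_0_less_mult_iff)
  have "\<not> p dvd d"
  proof
    assume "p dvd d"
    with cop(1) have "p dvd 1" by (rule coprime_common_divisor[OF _ dvd_refl])
    with \<open>prime p\<close> show False by (simp add: not_prime_unit)
  qed
  then have "int_eval (w ^ p) f = 0"
    by (rule vanishing_at_prime_power[OF f dvd factor.prems(3) \<open>prime p\<close>])
  then have "int_eval ((w ^ p) ^ k) f = 0"
    by (rule factor.IH[OF cop(2) k])
  then show ?case by (simp only: power_mult)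
qed simp_all

text \<open>
  This is the irreducibility of the cyclotomic polynomials over the rationals, in the form in which
  it is used: the powers of \<open>w\<close> with exponent prime to \<open>d\<close> cannot be told apart from \<open>w\<close> by
  integer polynomials.
\<close>
lemma conjugate_roots_of_unity:
  assumes "w ^ d = 1" "d > 0" "coprime k d" "k > 0" "int_eval w P = 0"
  shows "int_eval (w ^ k) P = 0"
proof -
  have "monom 1 d - 1 \<noteq> (0 :: int poly)"
    using degree_monom_minus_one[OF \<open>d > 0\<close>] \<open>d > 0\<close> by auto
  moreover have "int_eval w (monom 1 d - 1) = 0"
    using assms by (simp add: int_eval_hom poly_monom)
  ultimately obtain f where f: "prime f" "f dvd monom 1 d - 1" "int_eval w f = 0"
    using exists_prime_factor_vanishing by blast
  then have "f dvd P" using prime_dvd_if_common_root assms by blast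
  moreover have "int_eval (w ^ k) f = 0" using vanishing_at_coprime_power f assms by blast
  ultimately show ?thesis by (auto simp: int_eval_hom)
qed

section \<open>Divisibility by cyclotomic polynomials\<close>

lemma eps_power: "eps d ^ k = exp (2 * of_real pi * \<i> * of_nat k / of_nat d)"
  unfolding eps_def exp_of_nat_mult[symmetric] by (simp add: mult_ac)

lemma eps_power_self [simp]: "d > 0 \<Longrightarrow> eps d ^ d = 1"
  unfolding eps_power by (simp add: exp_eq_1)

lemma eps_power_eq_iff: "d > 0 \<Longrightarrow> eps d ^ j = eps d ^ k \<longleftrightarrow> j mod d = k mod d"
  unfolding eps_power using complex_root_unity_eq[of d j k] by simp

lemma eps_power_reduce:
  assumes "m > 0" "j > 0"
  shows "eps m ^ j = eps (m div gcd m j) ^ (j div gcd m j)"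
proof -
  define c where "c = gcd m j"
  obtain m' j' where "m = c * m'" "j = c * j'" unfolding c_def by (meson dvdE gcd_dvd1 gcd_dvd2)
  moreover have "c > 0" using assms unfolding c_def by simp
  ultimately show ?thesis unfolding eps_power c_def[symmetric] by (simp add: mult_ac)
qed

lemma prod_linear_factors_dvd_iff:
  fixes Q :: "'a::field poly"
  assumes "finite A" "inj_on r A"
  shows "(\<Prod>k\<in>A. [:- r k, 1:]) dvd Q \<longleftrightarrow> (\<forall>k\<in>A. poly Q (r k) = 0)"
proof
  assume "(\<Prod>k\<in>A. [:- r k, 1:]) dvd Q"
  then show "\<forall>k\<in>A. poly Q (r k) = 0"
    using assms by (metis (no_types, lifting) dvd_prodI dvd_trans poly_eq_0_iff_dvd)
next
  assume "\<forall>k\<in>A. poly Q (r k) = 0"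
  with assms show "(\<Prod>k\<in>A. [:- r k, 1:]) dvd Q"
  proof (induction A arbitrary: Q rule: finite_induct)
    case (insert a A)
    then obtain S where S: "Q = [:- r a, 1:] * S" using poly_eq_0_iff_dvd by (metis dvdE insertI1)
    have "poly S (r k) = 0" if "k \<in> A" for k
      using insert that unfolding S by (auto simp: inj_on_def)
    then have "(\<Prod>k\<in>A. [:- r k, 1:]) dvd S" using insert by auto
    then show ?case unfolding S using insert by (simp add: mult_dvd_mono del: mult_pCons_left)
  qed simp
qed

text \<open>
  Any two primitive \<open>d\<close>-th roots of unity are powers of each other with exponents prime to \<open>d\<close>, so
  the vanishing at all roots of the cyclotomic polynomial is decided at a single one.
\<close>
lemma cyclotomic_dvd_iff:
  assumes d: "d > 0" and k: "coprime k d"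
  shows "cyclotomic d dvd map_poly of_int P \<longleftrightarrow> int_eval (eps d ^ k) P = 0"
proof -
  let ?A = "{i. i \<in> {1..d} \<and> coprime i d}"
  have "inj_on (\<lambda>i. eps d ^ i) ?A"
  proof (rule inj_onI)
    fix i j assume "i \<in> ?A" "j \<in> ?A" "eps d ^ i = eps d ^ j"
    then have "i mod d = j mod d" "i \<in> {1..d}" "j \<in> {1..d}" using d by (auto simp: eps_power_eq_iff)
    then show "i = j" by (cases "i = d"; cases "j = d") auto
  qed
  then have "cyclotomic d dvd map_poly of_int P \<longleftrightarrow> (\<forall>i\<in>?A. int_eval (eps d ^ i) P = 0)"
    unfolding cyclotomic_def by (intro prod_linear_factors_dvd_iff) auto
  also have "\<dots> \<longleftrightarrow> int_eval (eps d ^ k) P = 0"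
  proof -
    have conj: "int_eval (eps d ^ i) P = 0"
      if j: "int_eval (eps d ^ j) P = 0" "coprime j d" and i: "coprime i d" for i j
    proof -
      obtain x where x: "[j * x = 1] (mod d)" using cong_solve_coprime_nat[OF j(2)] by auto
      \<comment> \<open>Adding \<open>d\<close> keeps the exponent positive even if \<open>d = 1\<close>.\<close>
      define e where "e = (x * i) mod d + d"
      have "[j * e = i] (mod d)"
      proof -
        have "[j * e = (j * x) * i] (mod d)" unfolding e_def cong_def
          by (simp add: mod_mult_right_eq mult.assoc distrib_left)
        also have "[(j * x) * i = 1 * i] (mod d)" by (intro cong_mult x) simp
        finally show ?thesis by simp
      qed
      then have eq: "(eps d ^ j) ^ e = eps d ^ i"
        using d by (simp add: eps_power_eq_iff cong_def flip: power_mult)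
      have "coprime e d"
        using \<open>[j * e = i] (mod d)\<close> i cong_imp_coprime[of i "j * e" d]
        by (metis cong_sym coprime_mult_left_iff)
      moreover have "(eps d ^ j) ^ d = 1" using d by (metis eps_power_self mult.commute power_mult power_one)
      ultimately show ?thesis
        using conjugate_roots_of_unity[of "eps d ^ j" d e P] j d eq by (auto simp: e_def)
    qed
    have "1 \<in> ?A" using d by simp
    then show ?thesis using conj[of _ k] conj[of k] k
      by (metis (mono_tags, lifting) coprime_1_left mem_Collect_eq)
  qed
  finally show ?thesis .
qed

section \<open>Integrals along cycles\<close>

lemma int_eval_cycle_poly:
  "int_eval w (cycle_poly m n) = (\<Sum>i=1..m. of_int (n i) * w ^ (i - 1))"
proof -
  have "map_poly of_int (cycle_poly m n) = (\<Sum>i=1..m. monom (of_int (n i) :: complex) (i - 1))"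
    unfolding cycle_poly_def
    by (rule poly_eqI) (simp add: coeff_map_poly coeff_sum if_distrib[of of_int] cong: if_cong)
  then show ?thesis by (simp add: poly_sum poly_monom)
qed

text \<open>
  The value of \<open>z\<^sup>j\<close> at the \<open>i\<close>-th root is \<open>(\<epsilon>\<^sup>j)\<^bsup>i-1\<^esup> s\<^sup>j\<close>, so that the sum over the roots becomes
  the cycle polynomial at \<open>\<epsilon>\<^sup>j\<close>.
\<close>
lemma cycle_integral_eq:
  "cycle_integral m n s g t =
    (\<Sum>j\<le>degree g. coeff g j * int_eval (eps m ^ j) (cycle_poly m n) * s t ^ j)"
proof -
  have "cycle_integral m n s g t =
      (\<Sum>i=1..m. \<Sum>j\<le>degree g. of_int (n i) * (coeff g j * (eps m ^ (i - 1) * s t) ^ j))"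
    unfolding cycle_integral_def nth_root_def poly_altdef sum_distrib_left ..
  also have "\<dots> = (\<Sum>j\<le>degree g. \<Sum>i=1..m. of_int (n i) * (coeff g j * (eps m ^ (i - 1) * s t) ^ j))"
    by (rule sum.swap)
  also have "\<dots> = (\<Sum>j\<le>degree g. coeff g j * int_eval (eps m ^ j) (cycle_poly m n) * s t ^ j)"
    unfolding int_eval_cycle_poly sum_distrib_left sum_distrib_right
    by (intro sum.cong refl)
      (simp add: power_mult_distrib mult_ac flip: power_mult)
  finally show ?thesis .
qed

text \<open>
  The polynomial \<open>f\<close> maps the values of the branch back onto the nonempty open set \<open>U\<close>, which is
  infinite.
\<close>
lemma infinite_branch_image:
  assumes "root_branch f U s"
  shows "infinite (s ` U)"
proof
  assume "finite (s ` U)"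
  then have "finite (poly f ` s ` U)" by simp
  moreover have "poly f ` s ` U = U" using assms unfolding root_branch_def by (force simp: image_image)
  ultimately show False using assms finite_imp_not_open unfolding root_branch_def by metis
qed

lemma cycle_integral_zero_iff:
  assumes "root_branch f U s"
  shows "(\<forall>t\<in>U. cycle_integral m n s g t = 0) \<longleftrightarrow>
    (\<forall>j. coeff g j = 0 \<or> int_eval (eps m ^ j) (cycle_poly m n) = 0)"
proof -
  define c where "c j = coeff g j * int_eval (eps m ^ j) (cycle_poly m n)" for j
  define q where "q = (\<Sum>j\<le>degree g. monom (c j) j)"
  have q: "cycle_integral m n s g t = poly q (s t)" for t
    unfolding cycle_integral_eq q_def c_def by (simp add: poly_sum poly_monom)
  have coeff_q: "coeff q j = c j" for j
    unfolding q_def c_def by (simp add: coeff_sum coeff_eq_0)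
  have "(\<forall>t\<in>U. poly q (s t) = 0) \<longleftrightarrow> q = 0"
  proof
    assume "\<forall>t\<in>U. poly q (s t) = 0"
    then have "s ` U \<subseteq> {x. poly q x = 0}" by blast
    then show "q = 0" using infinite_branch_image[OF assms] poly_roots_finite finite_subset by blast
  qed simp
  also have "\<dots> \<longleftrightarrow> (\<forall>j. c j = 0)" by (simp add: poly_eq_iff coeff_q)
  finally show ?thesis by (simp add: q c_def)
qed

theorem proposition7p3:
  fixes m :: nat and n :: "nat \<Rightarrow> int" and g :: "complex poly"
    and U :: "complex set" and s :: "complex \<Rightarrow> complex"
  assumes "m > 1"
    and "root_branch (monom 1 m) U s"
    and "is_cycle m n"
    and "balanced m n"
  shows "(\<forall>t\<in>U. cycle_integral m n s g t = 0) \<longleftrightarrow>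
    (\<forall>j>1. \<not> cyclotomic (m div gcd m j) dvd map_poly of_int (cycle_poly m n) \<longrightarrow> coeff g j = 0)"
proof -
  let ?P = "cycle_poly m n"
  have "int_eval 1 ?P = of_int (\<Sum>i=1..m. n i)"
    by (simp only: int_eval_cycle_poly power_one mult_1_right of_int_sum)
  then have P0: "int_eval (eps m ^ 0) ?P = 0" using assms(3) by (simp add: is_cycle_def del: of_int_sum)
  \<comment> \<open>The defining sum of a balanced cycle carries one more factor \<open>\<epsilon>\<close> than the cycle polynomial.\<close>
  have "eps m * int_eval (eps m) ?P = (\<Sum>i=1..m. of_int (n i) * eps m ^ i)"
    unfolding int_eval_cycle_poly sum_distrib_left
    by (intro sum.cong refl) (auto simp: mult_ac simp flip: power_Suc)
  then have P1: "int_eval (eps m ^ 1) ?P = 0" using assms by (simp add: balanced_def eps_def)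
  have cyc: "cyclotomic (m div gcd m j) dvd map_poly of_int ?P \<longleftrightarrow> int_eval (eps m ^ j) ?P = 0"
    if "j > 1" for j
  proof -
    have "gcd m j > 0" "gcd m j \<le> m" using assms by (auto simp: gcd_le1_nat)
    then have "m div gcd m j > 0" by (simp add: div_greater_zero_iff)
    moreover have "coprime (j div gcd m j) (m div gcd m j)"
      using assms that by (metis coprime_commute div_gcd_coprime not_one_less_zero)
    moreover have "eps m ^ j = eps (m div gcd m j) ^ (j div gcd m j)"
      using assms that by (intro eps_power_reduce) auto
    ultimately show ?thesis using cyclotomic_dvd_iff by metis
  qed
  have "(\<forall>t\<in>U. cycle_integral m n s g t = 0) \<longleftrightarrow>
      (\<forall>j. coeff g j = 0 \<or> int_eval (eps m ^ j) ?P = 0)"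
    by (rule cycle_integral_zero_iff[OF assms(2)])
  also have "\<dots> \<longleftrightarrow> (\<forall>j>1. coeff g j = 0 \<or> int_eval (eps m ^ j) ?P = 0)"
    using P0 P1 by (metis less_one linorder_neqE_nat)
  also have "\<dots> \<longleftrightarrow> (\<forall>j>1. \<not> cyclotomic (m div gcd m j) dvd map_poly of_int ?P \<longrightarrow> coeff g j = 0)"
    using cyc by blast
  finally show ?thesis .
qed

end
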